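(* Let $\beta\ge2$, $\gamma>0$, and let $d,L,R,L_\beta,\mu>0$ be fixed. Consider $$\mathcal{E}(N,B,\delta)=\frac{dL^2R^2}{\mu N}+\frac{L_\beta^{2/\beta}}{\mu}\left(\frac{d^2\delta^2}{BN}\right)^{\frac{\beta-1}{\beta}}+\frac{d^{1+2/\beta}L^2}{\mu N^{1+1/\beta}}\left(\frac{\delta^2}{BL_\beta^2}\right)^{1/\beta},$$ and the problem of minimizing the wall-clock time $T_{\rm total}=BN\delta^{-\gamma}$ over $N\ge1$, $B\ge1$, $0<\delta\le1$ subject to $\mathcal{E}(N,B,\delta)\le\varepsilon$, in the high-precision regime $\varepsilon\to0$. (i) If $0<\gamma<2$, batching is not beneficial at the leading order: the leading-order optimal design has $B^*=1$, $$N^*\asymp\frac{dL^2R^2}{\mu\varepsilon}\cdot\frac{2\beta-2+\gamma}{(\beta-1)(2-\gamma)},\qquad \delta^*\asymp d^{-1/2}LR\,\mu^{\frac1{2(\beta-1)}}L_\beta^{-\frac1{\beta-1}}\varepsilon^{\frac1{2(\beta-1)}}C_\beta(\gamma),$$ where $C_\beta(\gamma):=\left(\frac{\gamma\beta}{2\beta-2+\gamma}\right)^{\frac{\beta}{2(\beta-1)}}\left(\frac{2\beta-2+\gamma}{(\beta-1)(2-\gamma)}\right)^{1/2}$, and $$T^*_{\rm total}\asymp d^{\frac{2+\gamma}2}L^{2-\gamma}R^{2-\gamma}L_\beta^{\frac\gamma{\beta-1}}\mu^{-\frac{2\beta-2+\gamma}{2(\beta-1)}}\varepsilon^{-\frac{2\beta-2+\gamma}{2(\beta-1)}}C_\beta(\gamma).$$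 (ii) If $\gamma\ge2$, the optimum is attained (at leading order) at the boundary $\delta^*=1$, and $$T^*_{\rm total}\asymp d^2L_\beta^{2/(\beta-1)}\mu^{-\beta/(\beta-1)}\varepsilon^{-\beta/(\beta-1)}.$$ The same total-work order can be achieved either sequentially with $B=1$, or with a larger batch size and fewer sequential steps $N$.
   Context: Origin of the bound: $f:\mathbb{R}^d\to\mathbb{R}$ is smooth, $\mu$-strongly convex, $\ell=\lfloor\beta\rfloor$ times continuously differentiable with $\|f^{(\ell)}(x)-f^{(\ell)}(z)\|\le L_\beta\|x-z\|^{\beta-\ell}$, and $\|f^{(2)}(x)-f^{(2)}(z)\|\le L$ for all $x,z$. It is minimized by a zeroth-order method with $N$ iterations using a batched ($B$ independent copies) $\ell_2$-randomized gradient estimator under Tsybakov noise (oracle $f(x)+\xi$ with $\mathbb{E}[\xi^2\mid\mathcal{F}_k]\le\delta^2$, independent across queries) at per-query cost $c(\delta)=\delta^{-\gamma}$; $\mathcal{E}$ bounds $\mathbb{E}[f(\hat x_N)-f^*]$ up to constants. $\asymp$ denotes equality of orders as $\varepsilon\to0$ up to positive constants depending only on $\beta$ and $\gamma$. "Leading-order optimal" means optimal up to such constants in wall-clock time. *)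

theory Defs
  imports Complex_Main
begin

definition error_bound ::
  "real \<Rightarrow> real \<Rightarrow> real \<Rightarrow> real \<Rightarrow> real \<Rightarrow> real \<Rightarrow> nat \<Rightarrow> nat \<Rightarrow> real \<Rightarrow> real" where
  "error_bound \<beta> d L R L\<beta> \<mu> N B \<delta> =
     d * L^2 * R^2 / (\<mu> * real N)
   + L\<beta> powr (2 / \<beta>) / \<mu> * (d^2 * \<delta>^2 / (real B * real N)) powr ((\<beta> - 1) / \<beta>)
   + d powr (1 + 2 / \<beta>) * L^2 / (\<mu> * real N powr (1 + 1 / \<beta>))
       * (\<delta>^2 / (real B * L\<beta>^2)) powr (1 / \<beta>)"

definition total_time :: "real \<Rightarrow> nat \<Rightarrow> nat \<Rightarrow> real \<Rightarrow> real" where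
  "total_time \<gamma> N B \<delta> = real B * real N * \<delta> powr (- \<gamma>)"

definition feasible ::
  "real \<Rightarrow> real \<Rightarrow> real \<Rightarrow> real \<Rightarrow> real \<Rightarrow> real \<Rightarrow> real \<Rightarrow> nat \<Rightarrow> nat \<Rightarrow> real \<Rightarrow> bool" where
  "feasible \<beta> d L R L\<beta> \<mu> \<epsilon> N B \<delta> \<longleftrightarrow>
     1 \<le> N \<and> 1 \<le> B \<and> 0 < \<delta> \<and> \<delta> \<le> 1 \<and> error_bound \<beta> d L R L\<beta> \<mu> N B \<delta> \<le> \<epsilon>"

definition optimal_time ::
  "real \<Rightarrow> real \<Rightarrow> real \<Rightarrow> real \<Rightarrow> real \<Rightarrow> real \<Rightarrow> real \<Rightarrow> real \<Rightarrow> real" where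
  "optimal_time \<beta> \<gamma> d L R L\<beta> \<mu> \<epsilon> =
     Inf {total_time \<gamma> N B \<delta> | N B \<delta>. feasible \<beta> d L R L\<beta> \<mu> \<epsilon> N B \<delta>}"

text \<open>A design assigns to every accuracy a number of steps, a batch size and a noise level.
  The constant \<open>\<kappa>\<close> is an explicit argument, so that a statement can quantify it before the
  parameters \<open>d, L, R, L\<beta>, \<mu>\<close> and thereby make it independent of them.\<close>

definition leading_order_optimal ::
  "real \<Rightarrow> real \<Rightarrow> real \<Rightarrow> real \<Rightarrow> real \<Rightarrow> real \<Rightarrow> real \<Rightarrow> real
     \<Rightarrow> (real \<Rightarrow> nat) \<Rightarrow> (real \<Rightarrow> nat) \<Rightarrow> (real \<Rightarrow> real) \<Rightarrow> bool" where
  "leading_order_optimal \<kappa> \<beta> \<gamma> d L R L\<beta> \<mu> N B \<delta> \<longleftrightarrow>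
     (\<forall>\<^sub>F \<epsilon> in at_right 0.
        feasible \<beta> d L R L\<beta> \<mu> \<epsilon> (N \<epsilon>) (B \<epsilon>) (\<delta> \<epsilon>) \<and>
        total_time \<gamma> (N \<epsilon>) (B \<epsilon>) (\<delta> \<epsilon>) \<le> \<kappa> * optimal_time \<beta> \<gamma> d L R L\<beta> \<mu> \<epsilon>)"

text \<open>Equality of orders with an explicit constant. The Landau class \<open>\<Theta>[at_right 0](g)\<close> hides the
  constant, which could then depend on \<open>d, L, R, L\<beta>, \<mu>\<close>.\<close>

definition same_order :: "real \<Rightarrow> (real \<Rightarrow> real) \<Rightarrow> (real \<Rightarrow> real) \<Rightarrow> bool" where
  "same_order K f g \<longleftrightarrow> (\<forall>\<^sub>F \<epsilon> in at_right 0. g \<epsilon> / K \<le> f \<epsilon> \<and> f \<epsilon> \<le> K * g \<epsilon>)"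

definition design_const :: "real \<Rightarrow> real \<Rightarrow> real" where
  "design_const \<beta> \<gamma> =
     (\<gamma> * \<beta> / (2 * \<beta> - 2 + \<gamma>)) powr (\<beta> / (2 * (\<beta> - 1)))
   * ((2 * \<beta> - 2 + \<gamma>) / ((\<beta> - 1) * (2 - \<gamma>))) powr (1 / 2)"

end

theory Submission
  imports Defs
begin

text \<open>Each term of the error bound restricts a different combination of the design variables.
The first term involves \<open>N\<close> alone and forces \<open>N \<ge> s\<close> with \<open>s = d L\<^sup>2 R\<^sup>2 / (\<mu> \<epsilon>)\<close>. The second
involves \<open>B N / \<delta>\<^sup>2\<close> alone and forces \<open>B N \<ge> w \<delta>\<^sup>2\<close>, where \<open>w\<close> is of order
\<open>\<epsilon> powr (- \<beta> / (\<beta> - 1))\<close>. The third is the first multiplied by a factor that tends to \<open>0\<close>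
with \<open>\<delta>\<^sup>2 / (B N)\<close>, and the second requirement makes this ratio tend to \<open>0\<close>. So for small
\<open>\<epsilon>\<close>, up to the constant factors \<open>3\<close> and \<open>9\<close>, feasibility means \<open>N \<ge> s\<close> and \<open>B N \<ge> w \<delta>\<^sup>2\<close>
(lemmas \<open>feasible_imp_lower_bounds\<close> and \<open>eventually_feasible\<close>).

With \<open>m = B N\<close> it remains to minimize \<open>m \<delta> powr (- \<gamma>)\<close> subject to \<open>m \<ge> s\<close>, \<open>m \<ge> w \<delta>\<^sup>2\<close> and
\<open>\<delta> \<le> 1\<close>. The largest noise level that \<open>m\<close> permits is \<open>\<delta>\<^sup>2 = m / w\<close>, which gives the cost
\<open>m powr (1 - \<gamma> / 2) * w powr (\<gamma> / 2)\<close>.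

If \<open>\<gamma> < 2\<close>, this cost increases with \<open>m\<close>, so the optimum has \<open>m = s\<close>, that is \<open>N = s\<close>, \<open>B = 1\<close>
and \<open>\<delta>\<^sup>2 = s / w\<close>. The constraint \<open>\<delta> \<le> 1\<close> is not binding, because \<open>w / s\<close> tends to infinity.
Since the cost grows like a positive power of \<open>m\<close>, and for fixed \<open>m\<close> like a positive power of
\<open>1 / \<delta>\<close>, a design whose cost is within a constant factor of the optimum has \<open>m\<close> and \<open>\<delta>\<close>
within constant factors of theirs (lemma \<open>near_optimal_cost_controls_design\<close>); as \<open>N \<ge> s\<close>,
this also bounds \<open>B\<close>.

If \<open>\<gamma> \<ge> 2\<close>, then \<open>m \<delta> powr (- \<gamma>) \<ge> w \<delta> powr (2 - \<gamma>) \<ge> w\<close>, and \<open>\<delta> = 1\<close>, \<open>m = w\<close> attains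
this. Only the product \<open>B N\<close> is prescribed, so any batch size \<open>B \<le> w / s\<close> will do
(lemma \<open>eventually_unit_noise_design\<close>). Both \<open>B = 1\<close> and \<open>B = \<lfloor>sqrt (w / s)\<rfloor>\<close> qualify, and the
latter tends to infinity.

The factors in the closed forms that depend on \<open>\<beta>\<close> and \<open>\<gamma>\<close> only are absorbed into the constants
of equality of orders.\<close>

section \<open>The cost as a function of work and noise\<close>

lemma powr_le_powr_imp_le:
  fixes x y a :: real
  assumes "0 < a" "0 \<le> y" "x powr a \<le> y powr a"
  shows "x \<le> y"
  using assms powr_less_mono2[of a y x] by force

text \<open>The most noise that the work \<open>m\<close> permits is \<open>\<delta> = sqrt (m / w)\<close>; inserting it into the cost
removes \<open>\<delta>\<close>. The exponent \<open>1 - \<gamma> / 2\<close> of the work changes sign at \<open>\<gamma> = 2\<close>, which separates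
the two regimes.\<close>

lemma cost_lower_bound_without_noise:
  fixes m w \<delta> \<gamma> :: real
  assumes "0 < m" "0 < w" "0 < \<delta>" "0 < \<gamma>" and work: "w * \<delta>^2 \<le> m"
  shows "m powr (1 - \<gamma> / 2) * w powr (\<gamma> / 2) \<le> m * \<delta> powr (- \<gamma>)"
proof -
  have "\<delta> powr \<gamma> = (\<delta>^2) powr (\<gamma> / 2)"
    using assms by (simp add: powr_powr flip: powr_numeral)
  then have "w powr (\<gamma> / 2) * \<delta> powr \<gamma> = (w * \<delta>^2) powr (\<gamma> / 2)"
    using assms by (simp add: powr_mult)
  also have "\<dots> \<le> m powr (\<gamma> / 2)"
    using assms by (intro powr_mono2) auto
  finally have "w powr (\<gamma> / 2) \<le> m powr (\<gamma> / 2) * \<delta> powr (- \<gamma>)"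
    using assms by (simp add: powr_minus field_simps)
  then have "m powr (1 - \<gamma> / 2) * w powr (\<gamma> / 2)
      \<le> m powr (1 - \<gamma> / 2) * (m powr (\<gamma> / 2) * \<delta> powr (- \<gamma>))"
    by (intro mult_left_mono) auto
  also have "\<dots> = m * \<delta> powr (- \<gamma>)"
    using assms by (simp flip: mult.assoc powr_add)
  finally show ?thesis .
qed

text \<open>This is why the optimal design is unique up to constant factors when \<open>\<gamma> < 2\<close>.
The exponent of \<open>m\<close> in \<open>cost_lower_bound_without_noise\<close> is positive, so a near-optimal cost
bounds \<open>m\<close> from above, and then \<open>w * \<delta>\<^sup>2 \<le> m\<close> bounds \<open>\<delta>\<close> from above. Inserting \<open>m \<ge> s\<close> into the
cost itself bounds \<open>\<delta>\<close> from below.\<close>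

lemma near_optimal_cost_controls_design:
  fixes m s w \<delta> \<gamma> C :: real
  assumes "0 < s" "0 < w" "0 < \<delta>" "0 < \<gamma>" "\<gamma> < 2" "0 < C"
    and steps: "s \<le> m" and work: "w * \<delta>^2 \<le> m"
    and cost: "m * \<delta> powr (- \<gamma>) \<le> C * (s powr (1 - \<gamma> / 2) * w powr (\<gamma> / 2))"
  shows "m \<le> C powr (1 / (1 - \<gamma> / 2)) * s"
    and "\<delta> \<le> sqrt (C powr (1 / (1 - \<gamma> / 2))) * sqrt (s / w)"
    and "sqrt (s / w) \<le> C powr (1 / \<gamma>) * \<delta>"
proof -
  have m: "0 < m" using steps assms(1) by linarith
  have "m powr (1 - \<gamma> / 2) * w powr (\<gamma> / 2) \<le> C * s powr (1 - \<gamma> / 2) * w powr (\<gamma> / 2)"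
    using cost_lower_bound_without_noise[OF m assms(2-4) work] cost by simp
  then have "m powr (1 - \<gamma> / 2) \<le> C * s powr (1 - \<gamma> / 2)"
    using assms by simp
  also have "\<dots> = (C powr (1 / (1 - \<gamma> / 2)) * s) powr (1 - \<gamma> / 2)"
    using assms by (simp add: powr_mult powr_powr)
  finally show m_le: "m \<le> C powr (1 / (1 - \<gamma> / 2)) * s"
    by (rule powr_le_powr_imp_le[rotated 2]) (use assms in auto)
  have "\<delta>^2 \<le> C powr (1 / (1 - \<gamma> / 2)) * (s / w)"
    using work m_le assms by (simp add: field_simps)
  then show "\<delta> \<le> sqrt (C powr (1 / (1 - \<gamma> / 2))) * sqrt (s / w)"
    by (simp add: real_le_rsqrt flip: real_sqrt_mult)
  have "s * \<delta> powr (- \<gamma>) \<le> m * \<delta> powr (- \<gamma>)"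
    using steps by (intro mult_right_mono) auto
  also note cost
  also have "C * (s powr (1 - \<gamma> / 2) * w powr (\<gamma> / 2)) = s * (C * (w / s) powr (\<gamma> / 2))"
    using assms by (simp add: powr_diff powr_divide)
  finally have "\<delta> powr (- \<gamma>) \<le> C * (w / s) powr (\<gamma> / 2)"
    using assms by simp
  then have "(s / w) powr (\<gamma> / 2) \<le> C * \<delta> powr \<gamma>"
    using assms by (simp add: powr_minus powr_divide field_simps)
  moreover have "(s / w) powr (\<gamma> / 2) = sqrt (s / w) powr \<gamma>"
    using assms by (simp add: powr_powr flip: powr_half_sqrt)
  moreover have "C * \<delta> powr \<gamma> = (C powr (1 / \<gamma>) * \<delta>) powr \<gamma>"
    using assms by (simp add: powr_mult powr_powr)
  ultimately have "sqrt (s / w) powr \<gamma> \<le> (C powr (1 / \<gamma>) * \<delta>) powr \<gamma>" by simp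
  then show "sqrt (s / w) \<le> C powr (1 / \<gamma>) * \<delta>"
    by (rule powr_le_powr_imp_le[rotated 2]) (use assms in auto)
qed

section \<open>Orders of magnitude and the optimal time\<close>

text \<open>The constant \<open>c\<close> stands for the factors of the closed forms that depend on \<open>\<beta>\<close> and \<open>\<gamma>\<close> only,
so that the two-sided estimates can be proved for the plain reference function \<open>u\<close>.\<close>

lemma same_orderI:
  assumes "0 < K" "0 < c" "a * c \<le> K" "b / c \<le> K"
    and bounds: "\<forall>\<^sub>F \<epsilon> in at_right 0. 0 \<le> f \<epsilon> \<and> 0 \<le> u \<epsilon> \<and> u \<epsilon> \<le> a * f \<epsilon> \<and> f \<epsilon> \<le> b * u \<epsilon>"
    and g: "\<forall>\<^sub>F \<epsilon> in at_right 0. g \<epsilon> = u \<epsilon> * c"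
  shows "same_order K f g"
  unfolding same_order_def using bounds g
proof eventually_elim
  case (elim \<epsilon>)
  have "u \<epsilon> * c \<le> a * c * f \<epsilon>"
    using elim assms(2) by (simp add: mult_right_mono mult.commute mult.left_commute)
  also have "\<dots> \<le> K * f \<epsilon>"
    using elim assms(3) by (intro mult_right_mono) auto
  finally have "u \<epsilon> * c \<le> K * f \<epsilon>" .
  moreover have "b * u \<epsilon> \<le> K * c * u \<epsilon>"
    using elim assms(2,4) by (intro mult_right_mono) (auto simp: field_simps)
  ultimately show ?case
    using elim assms(1) by (auto simp: field_simps)
qed

text \<open>The infimum over an empty or unbounded set of reals is unspecified, so one feasible design
and one lower bound have to be supplied together.\<close>

lemma optimal_time_bounds:
  assumes lower: "\<And>N B \<delta>. feasible \<beta> d L R L\<beta> \<mu> \<epsilon> N B \<delta> \<Longrightarrow> t \<le> total_time \<gamma> N B \<delta>"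
    and feas: "feasible \<beta> d L R L\<beta> \<mu> \<epsilon> N B \<delta>"
  shows "t \<le> optimal_time \<beta> \<gamma> d L R L\<beta> \<mu> \<epsilon>"
    and "optimal_time \<beta> \<gamma> d L R L\<beta> \<mu> \<epsilon> \<le> total_time \<gamma> N B \<delta>"
proof -
  let ?S = "{total_time \<gamma> N B \<delta> | N B \<delta>. feasible \<beta> d L R L\<beta> \<mu> \<epsilon> N B \<delta>}"
  have "?S \<noteq> {}" using feas by blast
  then show "t \<le> optimal_time \<beta> \<gamma> d L R L\<beta> \<mu> \<epsilon>"
    unfolding optimal_time_def using lower by (intro cInf_greatest) auto
  have "bdd_below ?S" by (rule bdd_belowI[of _ t]) (use lower in auto)
  then show "optimal_time \<beta> \<gamma> d L R L\<beta> \<mu> \<epsilon> \<le> total_time \<gamma> N B \<delta>"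
    unfolding optimal_time_def using feas by (intro cInf_lower) auto
qed

section \<open>The two requirements behind the error bound\<close>

locale zeroth_order_problem =
  fixes \<beta> d L R L\<beta> \<mu> :: real
  assumes beta: "2 \<le> \<beta>"
    and pos: "0 < d" "0 < L" "0 < R" "0 < L\<beta>" "0 < \<mu>"
begin

text \<open>The number of steps at which the first term of the error bound equals \<open>\<epsilon>\<close>.\<close>

definition min_steps :: "real \<Rightarrow> real" where
  "min_steps \<epsilon> = d * L^2 * R^2 / (\<mu> * \<epsilon>)"

text \<open>The value of \<open>B N / \<delta>\<^sup>2\<close> at which the second term of the error bound equals \<open>\<epsilon>\<close>; at unit
noise this is the total number of queries.\<close>

definition min_work :: "real \<Rightarrow> real" where
  "min_work \<epsilon> = d^2 * L\<beta> powr (2 / (\<beta> - 1)) * (\<mu> * \<epsilon>) powr (- \<beta> / (\<beta> - 1))"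

lemma min_steps_pos: "0 < \<epsilon> \<Longrightarrow> 0 < min_steps \<epsilon>"
  using pos by (simp add: min_steps_def)

lemma min_work_pos: "0 < \<epsilon> \<Longrightarrow> 0 < min_work \<epsilon>"
  using pos by (simp add: min_work_def)

lemma ln_min_steps:
  "0 < \<epsilon> \<Longrightarrow> ln (min_steps \<epsilon>) = ln d + 2 * ln L + 2 * ln R - ln \<mu> - ln \<epsilon>"
  using pos by (simp add: min_steps_def ln_mult ln_div ln_realpow)

lemma ln_min_work:
  assumes "0 < \<epsilon>"
  shows "ln (min_work \<epsilon>) =
    2 * ln d + 1 / (\<beta> - 1) * (2 * ln L\<beta>) - (1 + 1 / (\<beta> - 1)) * (ln \<mu> + ln \<epsilon>)"
proof -
  have "\<beta> / (\<beta> - 1) = 1 + 1 / (\<beta> - 1)" using beta by (simp add: field_simps)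
  then have "- \<beta> / (\<beta> - 1) = - (1 + 1 / (\<beta> - 1))" by simp
  then show ?thesis
    unfolding min_work_def using pos assms
    by (simp only:) (simp add: ln_mult ln_realpow algebra_simps)
qed

lemma stochastic_term_at_min_work:
  assumes "0 < \<epsilon>"
  shows "L\<beta> powr (2 / \<beta>) / \<mu> * (d^2 / min_work \<epsilon>) powr ((\<beta> - 1) / \<beta>) = \<epsilon>"
    (is "?l = \<epsilon>")
proof -
  define r where "r = 1 / (\<beta> - 1)"
  have r: "(\<beta> - 1) * r = 1" using beta by (simp add: r_def)
  have "(\<beta> - 1) * (2 * ln d - ln (min_work \<epsilon>))
      = ((\<beta> - 1) + (\<beta> - 1) * r) * (ln \<mu> + ln \<epsilon>) - (\<beta> - 1) * r * (2 * ln L\<beta>)"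
    unfolding ln_min_work[OF assms] r_def[symmetric] by (simp add: algebra_simps)
  also have "\<dots> = \<beta> * (ln \<mu> + ln \<epsilon>) - 2 * ln L\<beta>" unfolding r by simp
  finally have scaled: "(\<beta> - 1) * (2 * ln d - ln (min_work \<epsilon>)) = \<beta> * (ln \<mu> + ln \<epsilon>) - 2 * ln L\<beta>" .
  have "(\<beta> - 1) * (2 * ln d - ln (min_work \<epsilon>)) / \<beta> = ln \<mu> + ln \<epsilon> - 2 / \<beta> * ln L\<beta>"
    unfolding scaled using beta by (simp add: diff_divide_distrib)
  moreover have "ln ?l
      = 2 / \<beta> * ln L\<beta> - ln \<mu> + (\<beta> - 1) * (2 * ln d - ln (min_work \<epsilon>)) / \<beta>"
    using pos min_work_pos[OF assms] by (simp add: ln_mult ln_div ln_realpow)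
  ultimately have "ln ?l = ln \<epsilon>" by simp
  then show ?thesis
    using pos assms min_work_pos[OF assms] by (subst (asm) ln_inj_iff) auto
qed

text \<open>Written as a multiple of the first term of the error bound, the third term is seen to be
negligible: the factor in parentheses depends on \<open>s\<^sup>2 / (b * n)\<close> only and vanishes with it.\<close>

lemma interaction_term_eq:
  assumes "0 < n" "0 < b" "0 < s"
  shows "d powr (1 + 2 / \<beta>) * L^2 / (\<mu> * n powr (1 + 1 / \<beta>)) * (s^2 / (b * L\<beta>^2)) powr (1 / \<beta>)
    = d * L^2 * R^2 / (\<mu> * n) * ((d^2 * s^2 / (b * n) / L\<beta>^2) powr (1 / \<beta>) / R^2)"
    (is "?l = ?r")
proof -
  have "ln ?l = ln ?r"
    using pos beta assms
    by (simp add: ln_mult ln_div ln_powr ln_realpow field_simps)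
  then show ?thesis
    using pos assms by (subst (asm) ln_inj_iff) auto
qed

section \<open>Closed forms and growth of the two requirements\<close>

lemma min_work_over_min_steps:
  assumes "0 < \<epsilon>"
  shows "min_work \<epsilon> / min_steps \<epsilon> =
    (d * L\<beta> powr (2 / (\<beta> - 1)) * \<mu> powr (- 1 / (\<beta> - 1)) / (L^2 * R^2)) * \<epsilon> powr (- 1 / (\<beta> - 1))"
    (is "?l = ?r")
proof -
  have "ln ?l = ln (min_work \<epsilon>) - ln (min_steps \<epsilon>)"
    using min_work_pos[OF assms] min_steps_pos[OF assms] by (simp add: ln_div)
  also have "\<dots> = ln ?r"
    unfolding ln_min_work[OF assms] ln_min_steps[OF assms] using pos assms
    by (simp add: ln_mult ln_div ln_realpow algebra_simps add_divide_distrib)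
  finally show ?thesis
    using pos assms min_work_pos min_steps_pos by (subst (asm) ln_inj_iff) auto
qed

lemma optimal_time_form:
  assumes "0 < \<epsilon>"
  shows "min_steps \<epsilon> powr (1 - \<gamma> / 2) * min_work \<epsilon> powr (\<gamma> / 2) =
     d powr ((2 + \<gamma>) / 2) * L powr (2 - \<gamma>) * R powr (2 - \<gamma>)
                * L\<beta> powr (\<gamma> / (\<beta> - 1))
                * \<mu> powr (- (2 * \<beta> - 2 + \<gamma>) / (2 * (\<beta> - 1)))
                * \<epsilon> powr (- (2 * \<beta> - 2 + \<gamma>) / (2 * (\<beta> - 1)))"
    (is "?l = ?r")
proof -
  define r g where "r = 1 / (\<beta> - 1)" and "g = \<gamma> / 2"
  have "2 * \<beta> - 2 + \<gamma> = 2 * (\<beta> - 1) * (1 + g * r)"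
    using beta by (simp add: r_def g_def distrib_left)
  then have exponents: "- (2 * \<beta> - 2 + \<gamma>) / (2 * (\<beta> - 1)) = - (1 + g * r)"
    "\<gamma> / (\<beta> - 1) = 2 * g * r" "(2 + \<gamma>) / 2 = 1 + g" "2 - \<gamma> = 2 - 2 * g"
    using beta by (simp_all add: r_def g_def)
  have "ln ?l = (1 - g) * ln (min_steps \<epsilon>) + g * ln (min_work \<epsilon>)"
    using min_work_pos[OF assms] min_steps_pos[OF assms] by (simp add: ln_mult g_def)
  also have "\<dots> = (1 + g) * ln d + (2 - 2 * g) * ln L + (2 - 2 * g) * ln R + 2 * g * r * ln L\<beta>
      + - (1 + g * r) * ln \<mu> + - (1 + g * r) * ln \<epsilon>"
    unfolding ln_min_work[OF assms] ln_min_steps[OF assms] r_def[symmetric]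
    by (simp add: algebra_simps)
  also have "\<dots> = ln ?r"
    unfolding exponents using pos assms by (simp only: ln_mult ln_powr powr_gt_zero
        mult_pos_pos mult_eq_0_iff powr_eq_0_iff order_less_imp_not_eq2 simp_thms if_True)
  finally show ?thesis
  proof (rule ln_inj_iff[THEN iffD1, rotated 2])
    show "0 < ?l" using min_work_pos[OF assms] min_steps_pos[OF assms] by simp
    show "0 < ?r" by (intro mult_pos_pos) (use pos assms in auto)
  qed
qed

lemma min_work_form:
  assumes "0 < \<epsilon>"
  shows "min_work \<epsilon> = d^2 * L\<beta> powr (2 / (\<beta> - 1)) * \<mu> powr (- \<beta> / (\<beta> - 1))
    * \<epsilon> powr (- \<beta> / (\<beta> - 1))"
  using pos assms by (simp add: min_work_def powr_mult)

lemma optimal_noise_form: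
  assumes "0 < \<epsilon>"
  shows "sqrt (min_steps \<epsilon> / min_work \<epsilon>) =
     d powr (- 1 / 2) * L * R * \<mu> powr (1 / (2 * (\<beta> - 1)))
                  * L\<beta> powr (- 1 / (\<beta> - 1)) * \<epsilon> powr (1 / (2 * (\<beta> - 1)))"
    (is "?l = ?r")
proof -
  define r where "r = 1 / (\<beta> - 1)"
  have exponents: "1 / (2 * (\<beta> - 1)) = r / 2" "- 1 / (\<beta> - 1) = - r"
    by (simp_all add: r_def)
  have "ln ?l = (ln (min_steps \<epsilon>) - ln (min_work \<epsilon>)) / 2"
    using min_work_pos[OF assms] min_steps_pos[OF assms] by (simp add: ln_sqrt ln_div)
  also have "\<dots> = ln ?r"
    unfolding ln_min_work[OF assms] ln_min_steps[OF assms] exponents r_def[symmetric]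
    using pos assms
    by (simp add: ln_mult) (simp add: algebra_simps add_divide_distrib diff_divide_distrib)
  finally show ?thesis
  proof (rule ln_inj_iff[THEN iffD1, rotated 2])
    show "0 < ?l" using min_work_pos[OF assms] min_steps_pos[OF assms] by simp
    show "0 < ?r" by (intro mult_pos_pos) (use pos assms in auto)
  qed
qed

lemma min_steps_at_top: "filterlim min_steps at_top (at_right 0)"
proof -
  have "filterlim (\<lambda>\<epsilon>::real. (d * L^2 * R^2 / \<mu>) * inverse \<epsilon>) at_top (at_right 0)"
    by (rule filterlim_tendsto_pos_mult_at_top[OF tendsto_const _ filterlim_inverse_at_top_right])
       (use pos in simp)
  moreover have "min_steps = (\<lambda>\<epsilon>. (d * L^2 * R^2 / \<mu>) * inverse \<epsilon>)"
    by (simp add: min_steps_def fun_eq_iff field_simps)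
  ultimately show ?thesis by simp
qed

text \<open>Noise reduction demands more work than the steps provide as \<open>\<epsilon>\<close> vanishes. For \<open>\<gamma> < 2\<close> this
keeps the optimal noise level below \<open>1\<close>; for \<open>\<gamma> \<ge> 2\<close> it leaves room for batching.\<close>

lemma min_work_over_min_steps_at_top:
  "filterlim (\<lambda>\<epsilon>. min_work \<epsilon> / min_steps \<epsilon>) at_top (at_right 0)"
proof -
  define c where "c = d * L\<beta> powr (2 / (\<beta> - 1)) * \<mu> powr (- 1 / (\<beta> - 1)) / (L^2 * R^2)"
  have c: "0 < c" using pos by (simp add: c_def)
  have "filterlim (\<lambda>\<epsilon>::real. - ln \<epsilon>) at_top (at_right 0)"
    using ln_at_0 by (simp add: filterlim_uminus_at_top)
  then have "filterlim (\<lambda>\<epsilon>::real. 1 / (\<beta> - 1) * - ln \<epsilon>) at_top (at_right 0)"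
    by (rule filterlim_tendsto_pos_mult_at_top[OF tendsto_const, rotated]) (use beta in simp)
  then have "filterlim (\<lambda>\<epsilon>::real. c * exp (1 / (\<beta> - 1) * - ln \<epsilon>)) at_top (at_right 0)"
    by (intro filterlim_tendsto_pos_mult_at_top[OF tendsto_const c] filterlim_compose[OF exp_at_top])
  then show ?thesis
  proof (rule filterlim_mono_eventually[OF _ order_refl order_refl])
    show "\<forall>\<^sub>F \<epsilon> in at_right 0. c * exp (1 / (\<beta> - 1) * - ln \<epsilon>) = min_work \<epsilon> / min_steps \<epsilon>"
      using eventually_at_right_less[of "0::real"]
      by eventually_elim (simp add: min_work_over_min_steps c_def powr_def)
  qed
qed

lemma min_work_at_top: "filterlim min_work at_top (at_right 0)"
proof -
  have "filterlim (\<lambda>\<epsilon>. min_work \<epsilon> / min_steps \<epsilon> * min_steps \<epsilon>) at_top (at_right 0)"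
    by (rule filterlim_at_top_mult_at_top[OF min_work_over_min_steps_at_top min_steps_at_top])
  then show ?thesis
  proof (rule filterlim_mono_eventually[OF _ order_refl order_refl])
    show "\<forall>\<^sub>F \<epsilon> in at_right 0. min_work \<epsilon> / min_steps \<epsilon> * min_steps \<epsilon> = min_work \<epsilon>"
      using eventually_at_right_less[of "0::real"]
      by eventually_elim (use min_steps_pos in force)
  qed
qed

section \<open>Feasibility up to constant factors\<close>

text \<open>All three terms of the error bound are nonnegative, so each of the first two is at most \<open>\<epsilon>\<close>
on its own.\<close>

lemma feasible_imp_lower_bounds:
  assumes "0 < \<epsilon>" and feas: "feasible \<beta> d L R L\<beta> \<mu> \<epsilon> N B \<delta>"
  shows "min_steps \<epsilon> \<le> real N" and "min_work \<epsilon> * \<delta>^2 \<le> real B * real N"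
proof -
  have N: "0 < real N" and B: "0 < real B" and \<delta>: "0 < \<delta>"
    using feas by (auto simp: feasible_def)
  define x where "x = d^2 * \<delta>^2 / (real B * real N)"
  have x: "0 < x" using N B \<delta> pos by (simp add: x_def)
  have t1: "0 \<le> d * L^2 * R^2 / (\<mu> * real N)" using N pos by simp
  have t2: "0 \<le> L\<beta> powr (2 / \<beta>) / \<mu> * x powr ((\<beta> - 1) / \<beta>)" using pos by simp
  have t3: "0 \<le> d powr (1 + 2 / \<beta>) * L^2 / (\<mu> * real N powr (1 + 1 / \<beta>))
       * (\<delta>^2 / (real B * L\<beta>^2)) powr (1 / \<beta>)" using pos by simp
  have le: "d * L^2 * R^2 / (\<mu> * real N) \<le> \<epsilon>"
    "L\<beta> powr (2 / \<beta>) / \<mu> * x powr ((\<beta> - 1) / \<beta>) \<le> \<epsilon>"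
    using feas t1 t2 t3 by (auto simp: feasible_def error_bound_def x_def)
  show "min_steps \<epsilon> \<le> real N"
    using le(1) N pos assms(1) by (simp add: min_steps_def field_simps)
  have "L\<beta> powr (2 / \<beta>) / \<mu> * x powr ((\<beta> - 1) / \<beta>)
      \<le> L\<beta> powr (2 / \<beta>) / \<mu> * (d^2 / min_work \<epsilon>) powr ((\<beta> - 1) / \<beta>)"
    using le(2) stochastic_term_at_min_work[OF assms(1)] by simp
  then have "x powr ((\<beta> - 1) / \<beta>) \<le> (d^2 / min_work \<epsilon>) powr ((\<beta> - 1) / \<beta>)"
    using pos by (subst (asm) mult_le_cancel_left_pos) auto
  then have "x \<le> d^2 / min_work \<epsilon>"
    by (rule powr_le_powr_imp_le[rotated 2]) (use beta min_work_pos[OF assms(1)] in auto)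
  then have "d^2 * (\<delta>^2 / (real B * real N)) \<le> d^2 * (1 / min_work \<epsilon>)"
    by (simp add: x_def)
  then have "\<delta>^2 / (real B * real N) \<le> 1 / min_work \<epsilon>"
    by (rule mult_left_le_imp_le) (use pos in simp)
  moreover have "0 < real B * real N" using N B by simp
  ultimately show "min_work \<epsilon> * \<delta>^2 \<le> real B * real N"
    using min_work_pos[OF assms(1)] by (simp add: pos_divide_le_eq pos_le_divide_eq mult.commute)
qed

text \<open>The converse of \<open>feasible_imp_lower_bounds\<close>, with the error budget \<open>\<epsilon>\<close> split into equal
thirds. The factor \<open>9\<close> suffices for every \<open>\<beta> \<ge> 2\<close>, since the exponent \<open>(\<beta> - 1) / \<beta>\<close> is then at
least \<open>1 / 2\<close>. Quantifying over the designs inside the filter makes the threshold for \<open>\<epsilon>\<close>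
uniform in them.\<close>

lemma eventually_feasible:
  "\<forall>\<^sub>F \<epsilon> in at_right 0. \<forall>N B \<delta>. 1 \<le> B \<longrightarrow> 0 < \<delta> \<longrightarrow> \<delta> \<le> 1 \<longrightarrow>
     3 * min_steps \<epsilon> \<le> real N \<longrightarrow> 9 * min_work \<epsilon> * \<delta>^2 \<le> real B * real N \<longrightarrow>
     feasible \<beta> d L R L\<beta> \<mu> \<epsilon> N B \<delta>"
proof -
  \<comment> \<open>\<open>W\<close> is the amount of work at which the third term falls below the first.\<close>
  define W where "W = d^2 / (L\<beta>^2 * (R^2) powr \<beta>)"
  have "\<forall>\<^sub>F \<epsilon> in at_right 0. W \<le> min_work \<epsilon>"
    using min_work_at_top by (simp add: filterlim_at_top)
  then show ?thesis using eventually_at_right_less[of "0::real"]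
  proof eventually_elim
    case (elim \<epsilon>)
    note W = elim(1) and \<epsilon> = elim(2)
    show ?case
    proof (intro allI impI)
      fix N B :: nat and \<delta> :: real
      assume B1: "1 \<le> B" and \<delta>: "0 < \<delta>" "\<delta> \<le> 1"
        and steps: "3 * min_steps \<epsilon> \<le> real N"
        and work: "9 * min_work \<epsilon> * \<delta>^2 \<le> real B * real N"
      have N: "0 < real N" using steps min_steps_pos[OF \<epsilon>] by linarith
      have B: "0 < real B" using B1 by simp
      have w: "0 < min_work \<epsilon>" by (rule min_work_pos[OF \<epsilon>])
      define x where "x = d^2 * \<delta>^2 / (real B * real N)"
      have x0: "0 < x" using N B \<delta> pos by (simp add: x_def)
      have x9: "x \<le> (1/9) * (d^2 / min_work \<epsilon>)"
      proof -
        have "0 < real B * real N" using N B by simp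
        with work w have "\<delta>^2 / (real B * real N) \<le> 1 / (9 * min_work \<epsilon>)"
          by (simp add: pos_divide_le_eq pos_le_divide_eq mult.commute)
        then have "d^2 * (\<delta>^2 / (real B * real N)) \<le> d^2 * (1 / (9 * min_work \<epsilon>))"
          by (rule mult_left_mono) simp
        then show ?thesis by (simp add: x_def)
      qed
      have first: "d * L^2 * R^2 / (\<mu> * real N) \<le> \<epsilon> / 3"
        using steps N pos \<epsilon> by (simp add: min_steps_def field_simps)
      have "(1/9::real) powr ((\<beta> - 1) / \<beta>) \<le> (1/9) powr (1/2)"
        using beta by (intro powr_mono') (auto simp: field_simps)
      also have "\<dots> = sqrt ((1/3)^2)"
        by (simp add: powr_half_sqrt power2_eq_square)
      also have "\<dots> = 1/3" by (simp only: real_sqrt_abs)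
      finally have third: "(1/9::real) powr ((\<beta> - 1) / \<beta>) \<le> 1/3" .
      have "L\<beta> powr (2 / \<beta>) / \<mu> * x powr ((\<beta> - 1) / \<beta>)
         \<le> L\<beta> powr (2 / \<beta>) / \<mu> * ((1/9) * (d^2 / min_work \<epsilon>)) powr ((\<beta> - 1) / \<beta>)"
        using x9 x0 pos beta by (intro mult_left_mono powr_mono2) auto
      also have "\<dots> = (1/9) powr ((\<beta> - 1) / \<beta>) *
          (L\<beta> powr (2 / \<beta>) / \<mu> * (d^2 / min_work \<epsilon>) powr ((\<beta> - 1) / \<beta>))"
        using w by (subst powr_mult) (auto simp only: mult_ac)
      also have "\<dots> = (1/9) powr ((\<beta> - 1) / \<beta>) * \<epsilon>"
        by (simp only: stochastic_term_at_min_work[OF \<epsilon>])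
      also have "\<dots> \<le> (1/3) * \<epsilon>"
        by (rule mult_right_mono[OF third]) (use \<epsilon> in simp)
      finally have second: "L\<beta> powr (2 / \<beta>) / \<mu> * x powr ((\<beta> - 1) / \<beta>) \<le> \<epsilon> / 3" by simp
      have "x \<le> d^2 / min_work \<epsilon>" using x9 x0 by simp
      also have "\<dots> \<le> d^2 / W"
        using W w pos by (intro divide_left_mono) (auto simp: W_def)
      also have "\<dots> = L\<beta>^2 * (R^2) powr \<beta>" using pos by (simp add: W_def)
      finally have "x / L\<beta>^2 \<le> (R^2) powr \<beta>" using pos by (simp add: field_simps)
      then have "(x / L\<beta>^2) powr (1 / \<beta>) \<le> ((R^2) powr \<beta>) powr (1 / \<beta>)"
        using x0 pos beta by (intro powr_mono2) auto
      also have "\<dots> = R^2" using pos beta by (simp add: powr_powr)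
      finally have "(x / L\<beta>^2) powr (1 / \<beta>) / R^2 \<le> 1" using pos by simp
      then have "d * L^2 * R^2 / (\<mu> * real N) * ((x / L\<beta>^2) powr (1 / \<beta>) / R^2)
          \<le> d * L^2 * R^2 / (\<mu> * real N)"
        using N pos by (intro mult_left_le) auto
      with first have
        "d * L^2 * R^2 / (\<mu> * real N) * ((x / L\<beta>^2) powr (1 / \<beta>) / R^2) \<le> \<epsilon> / 3"
        by linarith
      with first second have "error_bound \<beta> d L R L\<beta> \<mu> N B \<delta> \<le> \<epsilon>"
        unfolding error_bound_def interaction_term_eq[OF N B \<delta>(1)] x_def by linarith
      then show "feasible \<beta> d L R L\<beta> \<mu> \<epsilon> N B \<delta>"
        using N B1 \<delta> by (simp add: feasible_def)
    qed
  qed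
qed

lemma eventually_large:
  "\<forall>\<^sub>F \<epsilon> in at_right 0. 0 < \<epsilon> \<and> 1 \<le> min_steps \<epsilon> \<and> min_steps \<epsilon> \<le> min_work \<epsilon>"
proof -
  have "\<forall>\<^sub>F \<epsilon> in at_right 0. 1 \<le> min_steps \<epsilon>" "\<forall>\<^sub>F \<epsilon> in at_right 0. 1 \<le> min_work \<epsilon> / min_steps \<epsilon>"
    using min_steps_at_top min_work_over_min_steps_at_top by (simp_all add: filterlim_at_top)
  then show ?thesis using eventually_at_right_less[of "0::real"]
    by eventually_elim (simp add: field_simps)
qed

section \<open>Cheap noise reduction\<close>

lemma total_time_lower_cheap_noise:
  assumes "0 < \<epsilon>" "0 < \<gamma>" "\<gamma> < 2" and feas: "feasible \<beta> d L R L\<beta> \<mu> \<epsilon> N B \<delta>"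
  shows "min_steps \<epsilon> powr (1 - \<gamma> / 2) * min_work \<epsilon> powr (\<gamma> / 2) \<le> total_time \<gamma> N B \<delta>"
proof -
  have N: "1 \<le> real N" and B: "1 \<le> real B" and \<delta>: "0 < \<delta>" using feas by (auto simp: feasible_def)
  have "min_steps \<epsilon> \<le> 1 * real N" using feasible_imp_lower_bounds(1)[OF assms(1) feas] by simp
  also have "\<dots> \<le> real B * real N" using B by (intro mult_right_mono) auto
  finally have "min_steps \<epsilon> powr (1 - \<gamma> / 2) \<le> (real B * real N) powr (1 - \<gamma> / 2)"
    using min_steps_pos[OF assms(1)] assms by (intro powr_mono2) auto
  then have "min_steps \<epsilon> powr (1 - \<gamma> / 2) * min_work \<epsilon> powr (\<gamma> / 2)
      \<le> (real B * real N) powr (1 - \<gamma> / 2) * min_work \<epsilon> powr (\<gamma> / 2)"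
    by (intro mult_right_mono) auto
  also have "\<dots> \<le> real B * real N * \<delta> powr (- \<gamma>)"
    using N B \<delta> assms feasible_imp_lower_bounds(2)[OF assms(1) feas] min_work_pos[OF assms(1)]
    by (intro cost_lower_bound_without_noise) auto
  finally show ?thesis by (simp add: total_time_def)
qed

text \<open>Both requirements of \<open>eventually_feasible\<close> are met with the second one tight. Rounding turns
the factor \<open>3\<close> of the number of steps into at most \<open>4\<close>, which yields the total factor
\<open>36 = 4 * 9\<close>.\<close>

lemma eventually_cheap_noise_design:
  assumes "0 < \<gamma>" "\<gamma> < 2"
  defines "N \<equiv> \<lambda>\<epsilon>. nat \<lceil>3 * min_steps \<epsilon>\<rceil>"
  defines "\<delta> \<equiv> \<lambda>\<epsilon>. sqrt (real (N \<epsilon>) / (9 * min_work \<epsilon>))"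
  shows "\<forall>\<^sub>F \<epsilon> in at_right 0. feasible \<beta> d L R L\<beta> \<mu> \<epsilon> (N \<epsilon>) 1 (\<delta> \<epsilon>) \<and>
    total_time \<gamma> (N \<epsilon>) 1 (\<delta> \<epsilon>) \<le>
      36 * (min_steps \<epsilon> powr (1 - \<gamma> / 2) * min_work \<epsilon> powr (\<gamma> / 2))"
  using eventually_feasible eventually_large
proof eventually_elim
  case (elim \<epsilon>)
  define s w n where "s = min_steps \<epsilon>" and "w = min_work \<epsilon>" and "n = real (N \<epsilon>)"
  have s: "1 \<le> s" "s \<le> w" using elim by (auto simp: s_def w_def)
  have n: "3 * s \<le> n" "n \<le> 4 * s"
    using s unfolding n_def N_def s_def by linarith+
  have n0: "0 < n" using n s by linarith
  have \<delta>: "0 < \<delta> \<epsilon>" "\<delta> \<epsilon> \<le> 1" and \<delta>2: "(\<delta> \<epsilon>)^2 = n / (9 * w)"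
    using s n by (auto simp: \<delta>_def simp flip: w_def n_def)
  have "9 * w * (\<delta> \<epsilon>)^2 = n" using s by (simp add: \<delta>2)
  then have feas: "feasible \<beta> d L R L\<beta> \<mu> \<epsilon> (N \<epsilon>) 1 (\<delta> \<epsilon>)"
    using elim(1) \<delta> n by (simp add: s_def w_def n_def)
  have "total_time \<gamma> (N \<epsilon>) 1 (\<delta> \<epsilon>) = n * (n / (9 * w)) powr (- \<gamma> / 2)"
    using n s by (simp add: total_time_def \<delta>_def powr_powr flip: n_def w_def powr_half_sqrt)
  also have "\<dots> = n powr (1 - \<gamma> / 2) * (9 * w) powr (\<gamma> / 2)"
    using n0 s by (simp add: powr_divide powr_diff powr_minus_divide)
  also have "\<dots> \<le> (4 * s) powr (1 - \<gamma> / 2) * (9 * w) powr (\<gamma> / 2)"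
    using n s assms by (intro mult_right_mono powr_mono2) auto
  also have "\<dots> = (4 powr (1 - \<gamma> / 2) * 9 powr (\<gamma> / 2)) * (s powr (1 - \<gamma> / 2) * w powr (\<gamma> / 2))"
    using s by (simp add: powr_mult)
  also have "\<dots> \<le> (4 powr 1 * 9 powr 1) * (s powr (1 - \<gamma> / 2) * w powr (\<gamma> / 2))"
    using assms by (intro mult_right_mono mult_mono powr_mono) auto
  finally show ?case using feas by (simp add: s_def w_def)
qed

lemma optimal_time_cheap_noise:
  assumes "0 < \<gamma>" "\<gamma> < 2"
  defines "T \<equiv> \<lambda>\<epsilon>. min_steps \<epsilon> powr (1 - \<gamma> / 2) * min_work \<epsilon> powr (\<gamma> / 2)"
  shows "\<forall>\<^sub>F \<epsilon> in at_right 0. 0 < T \<epsilon> \<and> T \<epsilon> \<le> optimal_time \<beta> \<gamma> d L R L\<beta> \<mu> \<epsilon> \<and>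
    optimal_time \<beta> \<gamma> d L R L\<beta> \<mu> \<epsilon> \<le> 36 * T \<epsilon>"
  using eventually_cheap_noise_design[OF assms(1,2)] eventually_at_right_less[of "0::real"]
proof eventually_elim
  case (elim \<epsilon>)
  note bounds = optimal_time_bounds[OF total_time_lower_cheap_noise conjunct1[OF elim(1)],
      OF elim(2) assms(1,2)]
  have "0 < T \<epsilon>"
    using min_steps_pos[OF elim(2)] min_work_pos[OF elim(2)] by (simp add: T_def)
  with bounds elim(1) show ?case unfolding T_def by linarith
qed

lemma sequential_optimal_cheap_noise:
  assumes "0 < \<gamma>" "\<gamma> < 2"
  shows "\<exists>N \<delta>. leading_order_optimal 36 \<beta> \<gamma> d L R L\<beta> \<mu> N (\<lambda>_. 1) \<delta>"
proof (intro exI)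
  show "leading_order_optimal 36 \<beta> \<gamma> d L R L\<beta> \<mu> (\<lambda>\<epsilon>. nat \<lceil>3 * min_steps \<epsilon>\<rceil>) (\<lambda>_. 1)
      (\<lambda>\<epsilon>. sqrt (real (nat \<lceil>3 * min_steps \<epsilon>\<rceil>) / (9 * min_work \<epsilon>)))"
    unfolding leading_order_optimal_def
    using eventually_cheap_noise_design[OF assms] optimal_time_cheap_noise[OF assms]
    by eventually_elim auto
qed

text \<open>The first conclusion of \<open>near_optimal_cost_controls_design\<close> bounds the product \<open>B N\<close>. Since
\<open>N\<close> alone already exceeds \<open>min_steps\<close>, the same constant bounds the batch size.\<close>

lemma near_optimal_design_cheap_noise:
  fixes \<kappa> \<gamma> :: real
  assumes "0 < \<gamma>" "\<gamma> < 2" "0 < \<kappa>"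
    and opt: "leading_order_optimal \<kappa> \<beta> \<gamma> d L R L\<beta> \<mu> N B \<delta>"
  defines "K \<equiv> (36 * \<kappa>) powr (1 / (1 - \<gamma> / 2))"
  shows "\<forall>\<^sub>F \<epsilon> in at_right 0. 0 < \<epsilon> \<and>
     1 \<le> real (B \<epsilon>) \<and> real (B \<epsilon>) \<le> K \<and>
     min_steps \<epsilon> \<le> real (N \<epsilon>) \<and> real (N \<epsilon>) \<le> K * min_steps \<epsilon> \<and> 0 < \<delta> \<epsilon> \<and>
     sqrt (min_steps \<epsilon> / min_work \<epsilon>) \<le> (36 * \<kappa>) powr (1 / \<gamma>) * \<delta> \<epsilon> \<and>
     \<delta> \<epsilon> \<le> sqrt K * sqrt (min_steps \<epsilon> / min_work \<epsilon>)"
  using opt[unfolded leading_order_optimal_def] optimal_time_cheap_noise[OF assms(1,2)]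
    eventually_at_right_less[of "0::real"]
proof eventually_elim
  case (elim \<epsilon>)
  define s w m where "s = min_steps \<epsilon>" and "w = min_work \<epsilon>" and "m = real (B \<epsilon>) * real (N \<epsilon>)"
  have feas: "feasible \<beta> d L R L\<beta> \<mu> \<epsilon> (N \<epsilon>) (B \<epsilon>) (\<delta> \<epsilon>)" using elim by blast
  have N: "1 \<le> real (N \<epsilon>)" and B: "1 \<le> real (B \<epsilon>)" and \<delta>: "0 < \<delta> \<epsilon>"
    using feas by (auto simp: feasible_def)
  have s: "0 < s" and w: "0 < w" using elim min_steps_pos min_work_pos by (auto simp: s_def w_def)
  have sN: "s \<le> real (N \<epsilon>)" and work: "w * (\<delta> \<epsilon>)^2 \<le> m"
    using feasible_imp_lower_bounds[OF elim(3) feas] by (auto simp: s_def w_def m_def)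
  have Nm: "real (N \<epsilon>) \<le> m" using B N by (simp add: m_def)
  have "m * \<delta> \<epsilon> powr (- \<gamma>) \<le> \<kappa> * optimal_time \<beta> \<gamma> d L R L\<beta> \<mu> \<epsilon>"
    using elim by (simp add: total_time_def m_def)
  also have "\<dots> \<le> \<kappa> * (36 * (s powr (1 - \<gamma> / 2) * w powr (\<gamma> / 2)))"
    using elim assms(3) by (intro mult_left_mono) (auto simp: s_def w_def)
  finally have cost: "m * \<delta> \<epsilon> powr (- \<gamma>) \<le> 36 * \<kappa> * (s powr (1 - \<gamma> / 2) * w powr (\<gamma> / 2))"
    by simp
  note design = near_optimal_cost_controls_design[OF s w \<delta> assms(1,2) _ _ work cost,
      folded K_def]
  have m: "m \<le> K * s" using design(1) sN Nm assms(3) by simp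
  have "real (B \<epsilon>) * s \<le> K * s"
    using mult_left_mono[OF sN, of "real (B \<epsilon>)"] m by (simp add: m_def)
  then have "real (B \<epsilon>) \<le> K" using s by simp
  then show ?case
    using m design(2,3) sN Nm B \<delta> assms(3) elim(3) by (simp add: s_def w_def)
qed

section \<open>Expensive noise reduction\<close>

text \<open>Reducing the noise below \<open>1\<close> saves work by the factor \<open>\<delta>\<^sup>2\<close> but multiplies the price of a
query by \<open>\<delta> powr (- \<gamma>)\<close>, which for \<open>\<gamma> \<ge> 2\<close> never pays.\<close>

lemma total_time_lower_expensive_noise:
  assumes "0 < \<epsilon>" "2 \<le> \<gamma>" and feas: "feasible \<beta> d L R L\<beta> \<mu> \<epsilon> N B \<delta>"
  shows "min_work \<epsilon> \<le> total_time \<gamma> N B \<delta>"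
proof -
  have \<delta>: "0 < \<delta>" "\<delta> \<le> 1" using feas by (auto simp: feasible_def)
  have "min_work \<epsilon> = min_work \<epsilon> * \<delta>^2 * \<delta> powr (- 2)"
    using \<delta> by (simp add: powr_minus field_simps)
  also have "\<dots> \<le> (real B * real N) * \<delta> powr (- \<gamma>)"
    by (rule mult_mono[OF feasible_imp_lower_bounds(2)[OF assms(1) feas] powr_mono'])
       (use \<delta> assms(2) in auto)
  finally show ?thesis by (simp add: total_time_def)
qed

text \<open>At unit noise the work may be distributed between batch size and steps in any way that leaves
enough steps. The bound on \<open>b\<close> secures this, and it also keeps the rounding loss, at most \<open>b\<close>
queries, below \<open>min_work\<close>.\<close>

lemma eventually_unit_noise_design:
  assumes "2 \<le> \<gamma>"
    and b: "\<forall>\<^sub>F \<epsilon> in at_right 0. 1 \<le> b \<epsilon> \<and> real (b \<epsilon>) * min_steps \<epsilon> \<le> min_work \<epsilon>"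
  defines "N \<equiv> \<lambda>\<epsilon>. nat \<lceil>9 * min_work \<epsilon> / real (b \<epsilon>)\<rceil>"
  shows "\<forall>\<^sub>F \<epsilon> in at_right 0. feasible \<beta> d L R L\<beta> \<mu> \<epsilon> (N \<epsilon>) (b \<epsilon>) 1 \<and>
    total_time \<gamma> (N \<epsilon>) (b \<epsilon>) 1 \<le> 10 * min_work \<epsilon>"
  using b eventually_feasible eventually_large
proof eventually_elim
  case (elim \<epsilon>)
  define s w n where "s = min_steps \<epsilon>" and "w = min_work \<epsilon>" and "n = real (N \<epsilon>)"
  have s: "1 \<le> s" "s \<le> w" using elim by (auto simp: s_def w_def)
  have b: "1 \<le> real (b \<epsilon>)" "real (b \<epsilon>) * s \<le> w" using elim by (auto simp: s_def w_def)
  have "0 \<le> 9 * w / real (b \<epsilon>)" using s b by simp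
  then have n: "9 * w / real (b \<epsilon>) \<le> n" "n \<le> 9 * w / real (b \<epsilon>) + 1"
    unfolding n_def N_def w_def by linarith+
  have "3 * s \<le> 9 * w / real (b \<epsilon>)"
    using b s by (simp add: field_simps)
  with n have steps: "3 * s \<le> n" by linarith
  have work: "9 * w \<le> real (b \<epsilon>) * n" using n(1) b by (simp add: field_simps)
  have feas: "feasible \<beta> d L R L\<beta> \<mu> \<epsilon> (N \<epsilon>) (b \<epsilon>) 1"
    using elim(1,2) steps work by (simp add: s_def w_def n_def)
  have "real (b \<epsilon>) * n \<le> 9 * w + real (b \<epsilon>)"
    using mult_left_mono[OF n(2), of "real (b \<epsilon>)"] b(1) by (simp add: distrib_left)
  moreover have "real (b \<epsilon>) * 1 \<le> real (b \<epsilon>) * s" using s by (intro mult_left_mono) auto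
  ultimately have "real (b \<epsilon>) * n \<le> 10 * w" using b by linarith
  then show ?case using feas by (simp add: total_time_def n_def w_def)
qed

lemma optimal_time_expensive_noise:
  assumes "2 \<le> \<gamma>"
  shows "\<forall>\<^sub>F \<epsilon> in at_right 0. 0 < \<epsilon> \<and> min_work \<epsilon> \<le> optimal_time \<beta> \<gamma> d L R L\<beta> \<mu> \<epsilon> \<and>
    optimal_time \<beta> \<gamma> d L R L\<beta> \<mu> \<epsilon> \<le> 10 * min_work \<epsilon>"
proof -
  have "\<forall>\<^sub>F \<epsilon> in at_right 0. 1 \<le> (1::nat) \<and> real 1 * min_steps \<epsilon> \<le> min_work \<epsilon>"
    using eventually_large by eventually_elim simp
  from eventually_unit_noise_design[OF assms this] eventually_at_right_less[of "0::real"]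
  show ?thesis
  proof eventually_elim
    case (elim \<epsilon>)
    note optimal_time_bounds[OF total_time_lower_expensive_noise conjunct1[OF elim(1)],
        OF elim(2) assms]
    with elim show ?case by linarith
  qed
qed

lemma unit_noise_leading_order_optimal:
  assumes "2 \<le> \<gamma>"
    and "\<forall>\<^sub>F \<epsilon> in at_right 0. 1 \<le> b \<epsilon> \<and> real (b \<epsilon>) * min_steps \<epsilon> \<le> min_work \<epsilon>"
  shows "leading_order_optimal 10 \<beta> \<gamma> d L R L\<beta> \<mu>
     (\<lambda>\<epsilon>. nat \<lceil>9 * min_work \<epsilon> / real (b \<epsilon>)\<rceil>) b (\<lambda>_. 1)"
  unfolding leading_order_optimal_def
  using eventually_unit_noise_design[OF assms] optimal_time_expensive_noise[OF assms(1)]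
  by eventually_elim auto

text \<open>Any batch size that tends to infinity and stays below \<open>min_work / min_steps\<close> is a witness; the
square root of that ratio is a convenient choice.\<close>

lemma sequential_and_batched_optimal_expensive_noise:
  assumes "2 \<le> \<gamma>"
  shows "\<exists>N\<^sub>s\<^sub>e\<^sub>q N B.
         leading_order_optimal 10 \<beta> \<gamma> d L R L\<beta> \<mu> N\<^sub>s\<^sub>e\<^sub>q (\<lambda>_. 1) (\<lambda>_. 1)
       \<and> leading_order_optimal 10 \<beta> \<gamma> d L R L\<beta> \<mu> N B (\<lambda>_. 1)
       \<and> filterlim B at_top (at_right 0)
       \<and> ((\<lambda>\<epsilon>. real (N \<epsilon>) / real (N\<^sub>s\<^sub>e\<^sub>q \<epsilon>)) \<longlongrightarrow> 0) (at_right 0)"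
proof -
  define b where "b = (\<lambda>\<epsilon>. nat \<lfloor>sqrt (min_work \<epsilon> / min_steps \<epsilon>)\<rfloor>)"
  define N\<^sub>s\<^sub>e\<^sub>q where "N\<^sub>s\<^sub>e\<^sub>q = (\<lambda>\<epsilon>. nat \<lceil>9 * min_work \<epsilon> / real 1\<rceil>)"
  define N where "N = (\<lambda>\<epsilon>. nat \<lceil>9 * min_work \<epsilon> / real (b \<epsilon>)\<rceil>)"
  have b_at_top: "filterlim b at_top (at_right 0)"
    unfolding b_def
    by (intro filterlim_compose[OF filterlim_nat_sequentially]
        filterlim_compose[OF filterlim_floor_sequentially]
        filterlim_compose[OF sqrt_at_top] min_work_over_min_steps_at_top)
  have b: "\<forall>\<^sub>F \<epsilon> in at_right 0. 1 \<le> b \<epsilon> \<and> real (b \<epsilon>) * min_steps \<epsilon> \<le> min_work \<epsilon>"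
    using eventually_large
  proof eventually_elim
    case (elim \<epsilon>)
    define r where "r = min_work \<epsilon> / min_steps \<epsilon>"
    have r: "1 \<le> r" using elim by (simp add: r_def)
    then have "1 \<le> sqrt r" by simp
    moreover have "sqrt r \<le> r"
      using r mult_left_mono[OF \<open>1 \<le> sqrt r\<close>, of "sqrt r"] by simp
    ultimately have "1 \<le> b \<epsilon>" "real (b \<epsilon>) \<le> r"
      unfolding b_def r_def[symmetric] by linarith+
    then show ?case using elim by (simp add: r_def field_simps)
  qed
  have one: "\<forall>\<^sub>F \<epsilon> in at_right 0. 1 \<le> (1::nat) \<and> real 1 * min_steps \<epsilon> \<le> min_work \<epsilon>"
    using eventually_large by eventually_elim simp
  have "((\<lambda>\<epsilon>. inverse (real (b \<epsilon>)) + inverse (9 * min_work \<epsilon>)) \<longlongrightarrow> 0 + 0) (at_right 0)"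
    by (intro tendsto_add tendsto_inverse_0_at_top
        filterlim_compose[OF filterlim_real_sequentially b_at_top]
        filterlim_tendsto_pos_mult_at_top[OF tendsto_const _ min_work_at_top]) simp
  then have "((\<lambda>\<epsilon>. inverse (real (b \<epsilon>)) + inverse (9 * min_work \<epsilon>)) \<longlongrightarrow> 0) (at_right 0)"
    by simp
  then have lim: "((\<lambda>\<epsilon>. real (N \<epsilon>) / real (N\<^sub>s\<^sub>e\<^sub>q \<epsilon>)) \<longlongrightarrow> 0) (at_right 0)"
  proof (rule tendsto_0_le[where K = 1])
    show "\<forall>\<^sub>F \<epsilon> in at_right 0. norm (real (N \<epsilon>) / real (N\<^sub>s\<^sub>e\<^sub>q \<epsilon>)) \<le>
        norm (inverse (real (b \<epsilon>)) + inverse (9 * min_work \<epsilon>)) * 1"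
      using b eventually_large
    proof eventually_elim
      case (elim \<epsilon>)
      have w: "0 < min_work \<epsilon>" and b0: "0 < real (b \<epsilon>)" using elim by auto
      have "0 \<le> 9 * min_work \<epsilon> / real (b \<epsilon>)" using w by simp
      then have "real (N \<epsilon>) \<le> 9 * min_work \<epsilon> / real (b \<epsilon>) + 1" unfolding N_def by linarith
      moreover have "9 * min_work \<epsilon> \<le> real (N\<^sub>s\<^sub>e\<^sub>q \<epsilon>)" unfolding N\<^sub>s\<^sub>e\<^sub>q_def by linarith
      ultimately have "real (N \<epsilon>) / real (N\<^sub>s\<^sub>e\<^sub>q \<epsilon>)
          \<le> (9 * min_work \<epsilon> / real (b \<epsilon>) + 1) / (9 * min_work \<epsilon>)"
        using w b0 by (intro frac_le) auto
      also have "\<dots> = inverse (real (b \<epsilon>)) + inverse (9 * min_work \<epsilon>)"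
        using w b0 by (simp add: field_simps)
      finally show ?case using w b0 by simp
    qed
  qed
  show ?thesis
    using unit_noise_leading_order_optimal[OF assms one] unit_noise_leading_order_optimal[OF assms b]
      b_at_top lim unfolding N_def N\<^sub>s\<^sub>e\<^sub>q_def by blast
qed

end

section \<open>Optimal designs in both regimes\<close>

theorem proposition7:
  fixes \<beta> \<gamma> :: real
  assumes "\<beta> \<ge> 2" and "\<gamma> > 0"
  shows "(\<gamma> < 2 \<longrightarrow>
      (\<exists>\<kappa>>0. \<forall>d>0. \<forall>L>0. \<forall>R>0. \<forall>L\<beta>>0. \<forall>\<mu>>0.
         \<exists>N \<delta>. leading_order_optimal \<kappa> \<beta> \<gamma> d L R L\<beta> \<mu> N (\<lambda>_. 1) \<delta>)
    \<and> (\<forall>\<kappa>>0. \<exists>K>0. \<forall>d>0. \<forall>L>0. \<forall>R>0. \<forall>L\<beta>>0. \<forall>\<mu>>0. \<forall>N B \<delta>.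
         leading_order_optimal \<kappa> \<beta> \<gamma> d L R L\<beta> \<mu> N B \<delta> \<longrightarrow>
           same_order K (\<lambda>\<epsilon>. real (B \<epsilon>)) (\<lambda>\<epsilon>. 1)
         \<and> same_order K (\<lambda>\<epsilon>. real (N \<epsilon>))
             (\<lambda>\<epsilon>. d * L^2 * R^2 / (\<mu> * \<epsilon>)
                  * ((2 * \<beta> - 2 + \<gamma>) / ((\<beta> - 1) * (2 - \<gamma>))))
         \<and> same_order K \<delta>
             (\<lambda>\<epsilon>. d powr (- 1 / 2) * L * R * \<mu> powr (1 / (2 * (\<beta> - 1)))
                  * L\<beta> powr (- 1 / (\<beta> - 1)) * \<epsilon> powr (1 / (2 * (\<beta> - 1)))
                  * design_const \<beta> \<gamma>))
    \<and> (\<exists>K>0. \<forall>d>0. \<forall>L>0. \<forall>R>0. \<forall>L\<beta>>0. \<forall>\<mu>>0.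
         same_order K (\<lambda>\<epsilon>. optimal_time \<beta> \<gamma> d L R L\<beta> \<mu> \<epsilon>)
           (\<lambda>\<epsilon>. d powr ((2 + \<gamma>) / 2) * L powr (2 - \<gamma>) * R powr (2 - \<gamma>)
                * L\<beta> powr (\<gamma> / (\<beta> - 1))
                * \<mu> powr (- (2 * \<beta> - 2 + \<gamma>) / (2 * (\<beta> - 1)))
                * \<epsilon> powr (- (2 * \<beta> - 2 + \<gamma>) / (2 * (\<beta> - 1)))
                * design_const \<beta> \<gamma>)))
  \<and> (\<gamma> \<ge> 2 \<longrightarrow>
      (\<exists>K>0. \<forall>d>0. \<forall>L>0. \<forall>R>0. \<forall>L\<beta>>0. \<forall>\<mu>>0.
         same_order K (\<lambda>\<epsilon>. optimal_time \<beta> \<gamma> d L R L\<beta> \<mu> \<epsilon>)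
           (\<lambda>\<epsilon>. d^2 * L\<beta> powr (2 / (\<beta> - 1)) * \<mu> powr (- \<beta> / (\<beta> - 1))
                * \<epsilon> powr (- \<beta> / (\<beta> - 1))))
    \<and> (\<exists>\<kappa>>0. \<forall>d>0. \<forall>L>0. \<forall>R>0. \<forall>L\<beta>>0. \<forall>\<mu>>0. \<exists>N\<^sub>s\<^sub>e\<^sub>q N B.
         leading_order_optimal \<kappa> \<beta> \<gamma> d L R L\<beta> \<mu> N\<^sub>s\<^sub>e\<^sub>q (\<lambda>_. 1) (\<lambda>_. 1)
       \<and> leading_order_optimal \<kappa> \<beta> \<gamma> d L R L\<beta> \<mu> N B (\<lambda>_. 1)
       \<and> filterlim B at_top (at_right 0)
       \<and> ((\<lambda>\<epsilon>. real (N \<epsilon>) / real (N\<^sub>s\<^sub>e\<^sub>q \<epsilon>)) \<longlongrightarrow> 0) (at_right 0)))"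
proof (intro conjI impI)
  note problem = zeroth_order_problem.intro[OF assms(1)]
  {
    assume \<gamma>: "\<gamma> < 2"
    define c where "c = (2 * \<beta> - 2 + \<gamma>) / ((\<beta> - 1) * (2 - \<gamma>))"
    define D where "D = design_const \<beta> \<gamma>"
    have c: "0 < c" using assms \<gamma> by (simp add: c_def)
    have "0 < \<gamma> * \<beta> / (2 * \<beta> - 2 + \<gamma>)" using assms by simp
    then have D: "0 < D" using c unfolding D_def design_const_def c_def
      by (intro mult_pos_pos) (simp_all only: powr_gt_zero order_less_imp_not_eq2 simp_thms)
    show "\<exists>\<kappa>>0. \<forall>d>0. \<forall>L>0. \<forall>R>0. \<forall>L\<beta>>0. \<forall>\<mu>>0.
         \<exists>N \<delta>. leading_order_optimal \<kappa> \<beta> \<gamma> d L R L\<beta> \<mu> N (\<lambda>_. 1) \<delta>"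
      by (intro exI[of _ 36] conjI allI impI
          zeroth_order_problem.sequential_optimal_cheap_noise problem assms(2) \<gamma>) auto
    show "\<exists>K>0. \<forall>d>0. \<forall>L>0. \<forall>R>0. \<forall>L\<beta>>0. \<forall>\<mu>>0.
         same_order K (\<lambda>\<epsilon>. optimal_time \<beta> \<gamma> d L R L\<beta> \<mu> \<epsilon>)
           (\<lambda>\<epsilon>. d powr ((2 + \<gamma>) / 2) * L powr (2 - \<gamma>) * R powr (2 - \<gamma>)
                * L\<beta> powr (\<gamma> / (\<beta> - 1))
                * \<mu> powr (- (2 * \<beta> - 2 + \<gamma>) / (2 * (\<beta> - 1)))
                * \<epsilon> powr (- (2 * \<beta> - 2 + \<gamma>) / (2 * (\<beta> - 1)))
                * design_const \<beta> \<gamma>)"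
    proof (intro exI[of _ "D + 36 / D"] conjI allI impI)
      show "0 < D + 36 / D" using D by (simp add: add_pos_pos)
      fix d L R L\<beta> \<mu> :: real
      assume "0 < d" "0 < L" "0 < R" "0 < L\<beta>" "0 < \<mu>"
      then interpret zeroth_order_problem \<beta> d L R L\<beta> \<mu> by (rule problem)
      show "same_order (D + 36 / D) (\<lambda>\<epsilon>. optimal_time \<beta> \<gamma> d L R L\<beta> \<mu> \<epsilon>)
           (\<lambda>\<epsilon>. d powr ((2 + \<gamma>) / 2) * L powr (2 - \<gamma>) * R powr (2 - \<gamma>)
                * L\<beta> powr (\<gamma> / (\<beta> - 1))
                * \<mu> powr (- (2 * \<beta> - 2 + \<gamma>) / (2 * (\<beta> - 1)))
                * \<epsilon> powr (- (2 * \<beta> - 2 + \<gamma>) / (2 * (\<beta> - 1)))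
                * design_const \<beta> \<gamma>)"
      proof (rule same_orderI[where c = D and a = 1 and b = 36 and
            u = "\<lambda>\<epsilon>. min_steps \<epsilon> powr (1 - \<gamma> / 2) * min_work \<epsilon> powr (\<gamma> / 2)"])
        show "\<forall>\<^sub>F \<epsilon> in at_right 0. 0 \<le> optimal_time \<beta> \<gamma> d L R L\<beta> \<mu> \<epsilon> \<and>
          0 \<le> min_steps \<epsilon> powr (1 - \<gamma> / 2) * min_work \<epsilon> powr (\<gamma> / 2) \<and>
          min_steps \<epsilon> powr (1 - \<gamma> / 2) * min_work \<epsilon> powr (\<gamma> / 2)
            \<le> 1 * optimal_time \<beta> \<gamma> d L R L\<beta> \<mu> \<epsilon> \<and>
          optimal_time \<beta> \<gamma> d L R L\<beta> \<mu> \<epsilon>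
            \<le> 36 * (min_steps \<epsilon> powr (1 - \<gamma> / 2) * min_work \<epsilon> powr (\<gamma> / 2))"
          using optimal_time_cheap_noise[OF assms(2) \<gamma>] by eventually_elim linarith
      qed (use D eventually_at_right_less[of "0::real"] in
          \<open>auto simp: add_pos_pos optimal_time_form D_def elim!: eventually_mono\<close>)
    qed
    show "\<forall>\<kappa>>0. \<exists>K>0. \<forall>d>0. \<forall>L>0. \<forall>R>0. \<forall>L\<beta>>0. \<forall>\<mu>>0. \<forall>N B \<delta>.
         leading_order_optimal \<kappa> \<beta> \<gamma> d L R L\<beta> \<mu> N B \<delta> \<longrightarrow>
           same_order K (\<lambda>\<epsilon>. real (B \<epsilon>)) (\<lambda>\<epsilon>. 1)
         \<and> same_order K (\<lambda>\<epsilon>. real (N \<epsilon>))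
             (\<lambda>\<epsilon>. d * L^2 * R^2 / (\<mu> * \<epsilon>)
                  * ((2 * \<beta> - 2 + \<gamma>) / ((\<beta> - 1) * (2 - \<gamma>))))
         \<and> same_order K \<delta>
             (\<lambda>\<epsilon>. d powr (- 1 / 2) * L * R * \<mu> powr (1 / (2 * (\<beta> - 1)))
                  * L\<beta> powr (- 1 / (\<beta> - 1)) * \<epsilon> powr (1 / (2 * (\<beta> - 1)))
                  * design_const \<beta> \<gamma>)"
    proof (intro allI impI)
      fix \<kappa> :: real
      assume \<kappa>: "0 < \<kappa>"
      define k where "k = (36 * \<kappa>) powr (1 / (1 - \<gamma> / 2))"
      define q where "q = (36 * \<kappa>) powr (1 / \<gamma>)"
      have k: "0 < k" and q: "0 < q" using \<kappa> by (simp_all add: k_def q_def)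
      \<comment> \<open>A sum of positive numbers dominates each of the six constants that are needed below.\<close>
      define K where "K = 1 + k + c + k / c + q * D + sqrt k / D"
      have parts: "0 < k / c" "0 < q * D" "0 < sqrt k / D" using k q c D by simp_all
      then have K: "0 < K" "1 \<le> K" "k \<le> K" "c \<le> K" "k / c \<le> K" "q * D \<le> K" "sqrt k / D \<le> K"
        unfolding K_def using k c by linarith+
      show "\<exists>K>0. \<forall>d>0. \<forall>L>0. \<forall>R>0. \<forall>L\<beta>>0. \<forall>\<mu>>0. \<forall>N B \<delta>.
         leading_order_optimal \<kappa> \<beta> \<gamma> d L R L\<beta> \<mu> N B \<delta> \<longrightarrow>
           same_order K (\<lambda>\<epsilon>. real (B \<epsilon>)) (\<lambda>\<epsilon>. 1)
         \<and> same_order K (\<lambda>\<epsilon>. real (N \<epsilon>))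
             (\<lambda>\<epsilon>. d * L^2 * R^2 / (\<mu> * \<epsilon>)
                  * ((2 * \<beta> - 2 + \<gamma>) / ((\<beta> - 1) * (2 - \<gamma>))))
         \<and> same_order K \<delta>
             (\<lambda>\<epsilon>. d powr (- 1 / 2) * L * R * \<mu> powr (1 / (2 * (\<beta> - 1)))
                  * L\<beta> powr (- 1 / (\<beta> - 1)) * \<epsilon> powr (1 / (2 * (\<beta> - 1)))
                  * design_const \<beta> \<gamma>)"
      proof (intro exI[of _ K] conjI[OF K(1)] allI impI)
        fix d L R L\<beta> \<mu> :: real and N B :: "real \<Rightarrow> nat" and \<delta> :: "real \<Rightarrow> real"
        assume "0 < d" "0 < L" "0 < R" "0 < L\<beta>" "0 < \<mu>"
          and opt: "leading_order_optimal \<kappa> \<beta> \<gamma> d L R L\<beta> \<mu> N B \<delta>"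
        then interpret zeroth_order_problem \<beta> d L R L\<beta> \<mu> by (intro problem)
        note design = near_optimal_design_cheap_noise[OF assms(2) \<gamma> \<kappa> opt,
            folded k_def q_def]
        have pos_ev: "\<forall>\<^sub>F \<epsilon> in at_right 0. 0 < min_steps \<epsilon> \<and> 0 < min_work \<epsilon>"
          using eventually_at_right_less[of "0::real"]
          by eventually_elim (auto intro: min_steps_pos min_work_pos)
        show "same_order K (\<lambda>\<epsilon>. real (B \<epsilon>)) (\<lambda>\<epsilon>. 1)
         \<and> same_order K (\<lambda>\<epsilon>. real (N \<epsilon>))
             (\<lambda>\<epsilon>. d * L^2 * R^2 / (\<mu> * \<epsilon>)
                  * ((2 * \<beta> - 2 + \<gamma>) / ((\<beta> - 1) * (2 - \<gamma>))))
         \<and> same_order K \<delta>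
             (\<lambda>\<epsilon>. d powr (- 1 / 2) * L * R * \<mu> powr (1 / (2 * (\<beta> - 1)))
                  * L\<beta> powr (- 1 / (\<beta> - 1)) * \<epsilon> powr (1 / (2 * (\<beta> - 1)))
                  * design_const \<beta> \<gamma>)"
        proof (intro conjI)
          show "same_order K (\<lambda>\<epsilon>. real (B \<epsilon>)) (\<lambda>\<epsilon>. 1)"
          proof (rule same_orderI[where c = 1 and a = 1 and b = k and u = "\<lambda>_. 1"])
            show "\<forall>\<^sub>F \<epsilon> in at_right 0. 0 \<le> real (B \<epsilon>) \<and> 0 \<le> (1::real) \<and>
                1 \<le> 1 * real (B \<epsilon>) \<and> real (B \<epsilon>) \<le> k * 1"
              using design by eventually_elim simp
          qed (use K in auto)
          show "same_order K (\<lambda>\<epsilon>. real (N \<epsilon>))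
             (\<lambda>\<epsilon>. d * L^2 * R^2 / (\<mu> * \<epsilon>)
                  * ((2 * \<beta> - 2 + \<gamma>) / ((\<beta> - 1) * (2 - \<gamma>))))"
          proof (rule same_orderI[where c = c and a = 1 and b = k and u = min_steps])
            show "\<forall>\<^sub>F \<epsilon> in at_right 0. 0 \<le> real (N \<epsilon>) \<and> 0 \<le> min_steps \<epsilon> \<and>
                min_steps \<epsilon> \<le> 1 * real (N \<epsilon>) \<and> real (N \<epsilon>) \<le> k * min_steps \<epsilon>"
              using design pos_ev by eventually_elim simp
          qed (use K c in \<open>auto simp: min_steps_def c_def\<close>)
          show "same_order K \<delta>
             (\<lambda>\<epsilon>. d powr (- 1 / 2) * L * R * \<mu> powr (1 / (2 * (\<beta> - 1)))
                  * L\<beta> powr (- 1 / (\<beta> - 1)) * \<epsilon> powr (1 / (2 * (\<beta> - 1)))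
                  * design_const \<beta> \<gamma>)"
          proof (rule same_orderI[where c = D and a = q and b = "sqrt k" and
                u = "\<lambda>\<epsilon>. sqrt (min_steps \<epsilon> / min_work \<epsilon>)"])
            show "\<forall>\<^sub>F \<epsilon> in at_right 0. 0 \<le> \<delta> \<epsilon> \<and> 0 \<le> sqrt (min_steps \<epsilon> / min_work \<epsilon>) \<and>
                sqrt (min_steps \<epsilon> / min_work \<epsilon>) \<le> q * \<delta> \<epsilon> \<and>
                \<delta> \<epsilon> \<le> sqrt k * sqrt (min_steps \<epsilon> / min_work \<epsilon>)"
              using design pos_ev by eventually_elim simp
            show "\<forall>\<^sub>F \<epsilon> in at_right 0. d powr (- 1 / 2) * L * R * \<mu> powr (1 / (2 * (\<beta> - 1)))
                  * L\<beta> powr (- 1 / (\<beta> - 1)) * \<epsilon> powr (1 / (2 * (\<beta> - 1)))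
                  * design_const \<beta> \<gamma> = sqrt (min_steps \<epsilon> / min_work \<epsilon>) * D"
              using eventually_at_right_less[of "0::real"]
              by eventually_elim (simp only: optimal_noise_form D_def)
          qed (use K D in auto)
        qed
      qed
    qed
  }
  {
    assume \<gamma>: "2 \<le> \<gamma>"
    show "\<exists>K>0. \<forall>d>0. \<forall>L>0. \<forall>R>0. \<forall>L\<beta>>0. \<forall>\<mu>>0.
         same_order K (\<lambda>\<epsilon>. optimal_time \<beta> \<gamma> d L R L\<beta> \<mu> \<epsilon>)
           (\<lambda>\<epsilon>. d^2 * L\<beta> powr (2 / (\<beta> - 1)) * \<mu> powr (- \<beta> / (\<beta> - 1))
                * \<epsilon> powr (- \<beta> / (\<beta> - 1)))"
    proof (intro exI[of _ 10] conjI allI impI)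
      fix d L R L\<beta> \<mu> :: real
      assume "0 < d" "0 < L" "0 < R" "0 < L\<beta>" "0 < \<mu>"
      then interpret zeroth_order_problem \<beta> d L R L\<beta> \<mu> by (rule problem)
      show "same_order 10 (\<lambda>\<epsilon>. optimal_time \<beta> \<gamma> d L R L\<beta> \<mu> \<epsilon>)
           (\<lambda>\<epsilon>. d^2 * L\<beta> powr (2 / (\<beta> - 1)) * \<mu> powr (- \<beta> / (\<beta> - 1))
                * \<epsilon> powr (- \<beta> / (\<beta> - 1)))"
      proof (rule same_orderI[where c = 1 and a = 1 and b = 10 and u = min_work])
        show "\<forall>\<^sub>F \<epsilon> in at_right 0. 0 \<le> optimal_time \<beta> \<gamma> d L R L\<beta> \<mu> \<epsilon> \<and> 0 \<le> min_work \<epsilon> \<and>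
            min_work \<epsilon> \<le> 1 * optimal_time \<beta> \<gamma> d L R L\<beta> \<mu> \<epsilon> \<and>
            optimal_time \<beta> \<gamma> d L R L\<beta> \<mu> \<epsilon> \<le> 10 * min_work \<epsilon>"
          using optimal_time_expensive_noise[OF \<gamma>]
        proof eventually_elim
          case (elim \<epsilon>)
          then show ?case using min_work_pos[of \<epsilon>] by linarith
        qed
        show "\<forall>\<^sub>F \<epsilon> in at_right 0. d^2 * L\<beta> powr (2 / (\<beta> - 1)) * \<mu> powr (- \<beta> / (\<beta> - 1))
                * \<epsilon> powr (- \<beta> / (\<beta> - 1)) = min_work \<epsilon> * 1"
          using eventually_at_right_less[of "0::real"]
          by eventually_elim (simp only: min_work_form mult_1_right)
      qed auto
    qed simp
    show "\<exists>\<kappa>>0. \<forall>d>0. \<forall>L>0. \<forall>R>0. \<forall>L\<beta>>0. \<forall>\<mu>>0. \<exists>N\<^sub>s\<^sub>e\<^sub>q N B.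
         leading_order_optimal \<kappa> \<beta> \<gamma> d L R L\<beta> \<mu> N\<^sub>s\<^sub>e\<^sub>q (\<lambda>_. 1) (\<lambda>_. 1)
       \<and> leading_order_optimal \<kappa> \<beta> \<gamma> d L R L\<beta> \<mu> N B (\<lambda>_. 1)
       \<and> filterlim B at_top (at_right 0)
       \<and> ((\<lambda>\<epsilon>. real (N \<epsilon>) / real (N\<^sub>s\<^sub>e\<^sub>q \<epsilon>)) \<longlongrightarrow> 0) (at_right 0)"
      by (intro exI[of _ 10] conjI allI impI problem \<gamma>
          zeroth_order_problem.sequential_and_batched_optimal_expensive_noise) auto
  }
qed

end
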